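(* Let $p$ and $q$ be arbitrary pure quaternions. Then: (a) For every $s,t\in\mathbb{R}$, $$\mathrm{Tr}(\phi_p(s)\phi_q(s)\phi_p(t)\phi_q(t))=\mathrm{Tr}(\phi_q(s)\phi_p(s)\phi_q(t)\phi_p(t)).$$ (b) When at least two of $r,s,t\in\mathbb{R}$ are equal, $$\mathrm{Tr}(\phi_p(r)\phi_q(r)\phi_p(s)\phi_q(s)\phi_p(t)\phi_q(t))=\mathrm{Tr}(\phi_q(r)\phi_p(r)\phi_q(s)\phi_p(s)\phi_q(t)\phi_p(t)).$$
   Context: $\mathbb{H}$ is the division ring of real quaternions. A quaternion is pure if its real part is zero. For a pure quaternion $p$ and $s\in\mathbb{R}$, $\phi_p(s)=e^{sp}=\sum_{i\ge0}\frac{1}{i!}s^ip^i$. For $x\in\mathbb{H}$, $\mathrm{Tr}(x)=x+\bar x=2\,\mathrm{Re}(x)$. *)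

theory Defs
  imports "HOL-Analysis.Analysis"
begin

section \<open>The division ring of real quaternions\<close>

text \<open>\<open>Quat a b c d\<close> is the quaternion \<open>a + b i + c j + d k\<close>.\<close>

codatatype quat = Quat (Re0: real) (Im1: real) (Im2: real) (Im3: real)

lemma quat_eqI: "\<lbrakk>Re0 x = Re0 y; Im1 x = Im1 y; Im2 x = Im2 y; Im3 x = Im3 y\<rbrakk> \<Longrightarrow> x = y"
  by (rule quat.expand) simp

lemma quat_eq_iff: "x = y \<longleftrightarrow> Re0 x = Re0 y \<and> Im1 x = Im1 y \<and> Im2 x = Im2 y \<and> Im3 x = Im3 y"
  by (auto intro: quat_eqI)

instantiation quat :: ab_group_add
begin

primcorec zero_quat where
  "Re0 0 = 0" | "Im1 0 = 0" | "Im2 0 = 0" | "Im3 0 = 0"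

primcorec plus_quat where
  "Re0 (x + y) = Re0 x + Re0 y"
| "Im1 (x + y) = Im1 x + Im1 y"
| "Im2 (x + y) = Im2 x + Im2 y"
| "Im3 (x + y) = Im3 x + Im3 y"

primcorec uminus_quat where
  "Re0 (- x) = - Re0 x"
| "Im1 (- x) = - Im1 x"
| "Im2 (- x) = - Im2 x"
| "Im3 (- x) = - Im3 x"

primcorec minus_quat where
  "Re0 (x - y) = Re0 x - Re0 y"
| "Im1 (x - y) = Im1 x - Im1 y"
| "Im2 (x - y) = Im2 x - Im2 y"
| "Im3 (x - y) = Im3 x - Im3 y"

instance
  by standard (simp_all add: quat_eq_iff)

end

instantiation quat :: real_vector
begin

primcorec scaleR_quat where
  "Re0 (scaleR r x) = r * Re0 x"
| "Im1 (scaleR r x) = r * Im1 x"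
| "Im2 (scaleR r x) = r * Im2 x"
| "Im3 (scaleR r x) = r * Im3 x"

instance
  by standard (simp_all add: quat_eq_iff algebra_simps)

end

text \<open>Hamilton's product: \<open>i\<^sup>2 = j\<^sup>2 = k\<^sup>2 = i j k = -1\<close>.\<close>

instantiation quat :: real_algebra_1
begin

primcorec one_quat where
  "Re0 1 = 1" | "Im1 1 = 0" | "Im2 1 = 0" | "Im3 1 = 0"

primcorec times_quat where
  "Re0 (x * y) = Re0 x * Re0 y - Im1 x * Im1 y - Im2 x * Im2 y - Im3 x * Im3 y"
| "Im1 (x * y) = Re0 x * Im1 y + Im1 x * Re0 y + Im2 x * Im3 y - Im3 x * Im2 y"
| "Im2 (x * y) = Re0 x * Im2 y - Im1 x * Im3 y + Im2 x * Re0 y + Im3 x * Im1 y"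
| "Im3 (x * y) = Re0 x * Im3 y + Im1 x * Im2 y - Im2 x * Im1 y + Im3 x * Re0 y"

instance
  by standard (simp_all add: quat_eq_iff algebra_simps)

end

primcorec qcnj :: "quat \<Rightarrow> quat" where
  "Re0 (qcnj x) = Re0 x"
| "Im1 (qcnj x) = - Im1 x"
| "Im2 (qcnj x) = - Im2 x"
| "Im3 (qcnj x) = - Im3 x"

instantiation quat :: real_inner
begin

definition inner_quat where
  "inner_quat x y = Re0 x * Re0 y + Im1 x * Im1 y + Im2 x * Im2 y + Im3 x * Im3 y"

definition norm_quat where
  "norm_quat (x :: quat) = sqrt (inner x x)"

definition sgn_quat where
  "sgn_quat (x :: quat) = x /\<^sub>R norm x"

definition dist_quat where
  "dist_quat (x :: quat) y = norm (x - y)"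

definition uniformity_quat where
  "(uniformity :: (quat \<times> quat) filter) = (INF e\<in>{0<..}. principal {(x, y). dist x y < e})"

definition open_quat where
  "open_quat (U :: quat set) \<longleftrightarrow> (\<forall>x\<in>U. eventually (\<lambda>(x', y). x' = x \<longrightarrow> y \<in> U) uniformity)"

instance
proof
  fix x y z :: quat and r :: real
  have sq: "inner x x = Re0 x ^ 2 + Im1 x ^ 2 + Im2 x ^ 2 + Im3 x ^ 2"
    by (simp add: inner_quat_def power2_eq_square)
  show "dist x y = norm (x - y)" by (rule dist_quat_def)
  show "sgn x = x /\<^sub>R norm x" by (rule sgn_quat_def)
  show "(uniformity :: (quat \<times> quat) filter) = (INF e\<in>{0<..}. principal {(x, y). dist x y < e})"
    by (rule uniformity_quat_def)
  show "open U \<longleftrightarrow> (\<forall>x\<in>U. \<forall>\<^sub>F (x', y) in uniformity. x' = x \<longrightarrow> y \<in> U)" for U :: "quat set"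
    by (rule open_quat_def)
  show "inner x y = inner y x" by (simp add: inner_quat_def mult.commute)
  show "inner (x + y) z = inner x z + inner y z" by (simp add: inner_quat_def algebra_simps)
  show "inner (r *\<^sub>R x) y = r * inner x y" by (simp add: inner_quat_def algebra_simps)
  show "0 \<le> inner x x" by (simp add: sq)
  show "inner x x = 0 \<longleftrightarrow> x = 0"
    by (simp add: sq quat_eq_iff add_nonneg_eq_0_iff)
  show "norm x = sqrt (inner x x)" by (rule norm_quat_def)
qed

end

lemma inner_quat_self_mult:
  "inner (x * y) (x * y) = inner x x * inner y (y :: quat)"
  unfolding inner_quat_def times_quat.sel by algebra

lemma quat_mult_qcnj: "x * qcnj x = of_real ((norm x)\<^sup>2)" "qcnj x * x = of_real ((norm x)\<^sup>2)"
  by (simp_all add: power2_norm_eq_inner inner_quat_def quat_eq_iff of_real_def algebra_simps)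

instantiation quat :: real_normed_div_algebra
begin

definition inverse_quat where
  "inverse_quat x = qcnj x /\<^sub>R (norm x)\<^sup>2"

definition divide_quat where
  "divide_quat (x :: quat) y = x * inverse y"

instance
proof
  fix x y :: quat
  show "x \<noteq> 0 \<Longrightarrow> inverse x * x = 1"
    by (simp add: inverse_quat_def quat_mult_qcnj of_real_def)
  show "x \<noteq> 0 \<Longrightarrow> x * inverse x = 1"
    by (simp add: inverse_quat_def quat_mult_qcnj of_real_def)
  show "inverse (0 :: quat) = 0" by (simp add: inverse_quat_def quat_eq_iff)
  show "x div y = x * inverse y" by (rule divide_quat_def)
  show "norm (x * y) = norm x * norm y"
    by (simp add: norm_quat_def inner_quat_self_mult real_sqrt_mult)
qed

end

text \<open>Being a Euclidean space makes \<^typ>\<open>quat\<close> a Banach algebra, so that the library's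
  exponential function is available.\<close>

instantiation quat :: euclidean_space
begin

definition Basis_quat where
  "Basis_quat = {Quat 1 0 0 0, Quat 0 1 0 0, Quat 0 0 1 0, Quat 0 0 0 1}"

instance
proof
  show "(Basis :: quat set) \<noteq> {}" "finite (Basis :: quat set)"
    by (simp_all add: Basis_quat_def)
  show "inner u v = (if u = v then 1 else 0)" if "u \<in> Basis" "v \<in> Basis" for u v :: quat
    using that unfolding Basis_quat_def by (elim insertE emptyE) (simp_all add: inner_quat_def)
  show "(\<forall>u\<in>Basis. inner x u = 0) \<longleftrightarrow> x = 0" for x :: quat
    by (simp add: Basis_quat_def inner_quat_def) (simp add: quat_eq_iff)
qed

end

section \<open>Pure quaternions, exponentials and traces\<close>

definition pure_quat :: "quat \<Rightarrow> bool" where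
  "pure_quat x \<longleftrightarrow> Re0 x = 0"

definition phi :: "quat \<Rightarrow> real \<Rightarrow> quat" where
  "phi p s = exp (s *\<^sub>R p)"

lemma phi_sums: "(\<lambda>i. (1 / fact i * s ^ i) *\<^sub>R p ^ i) sums phi p s"
  using exp_converges[of "s *\<^sub>R p"]
  by (simp add: phi_def divide_inverse mult.commute)

definition Tr :: "quat \<Rightarrow> quat" where
  "Tr x = x + qcnj x"

lemma Tr_eq: "Tr x = of_real (2 * Re0 x)"
  by (simp add: Tr_def quat_eq_iff of_real_def)

end

theory Submission
  imports Defs
begin

text \<open>A quaternion is a root of its characteristic polynomial, so \<open>exp x\<close> lies in the real span of
  \<open>1\<close> and \<open>x\<close>. Put \<open>A = \<phi>\<^sub>p(s) \<phi>\<^sub>q(s)\<close> and \<open>B = \<phi>\<^sub>p(t) \<phi>\<^sub>q(t)\<close>, and let \<open>A'\<close>, \<open>B'\<close> be the products in the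
  opposite order. Expanding in \<open>p\<close> and \<open>q\<close>, cyclicity of the real part gives
  \<open>Re (A B) = Re (A' B')\<close>, which is (a). When two of the three parameters are equal, cyclicity turns the
  trace in (b) into that of \<open>A A B\<close>, and \<open>A\<^sup>2 = 2 Re(A) A - |A|\<^sup>2\<close> reduces (b) to (a), since
  \<open>A\<close> and \<open>A'\<close> have the same real part and the same norm.\<close>

lemma quat_square: "x * x = (2 * Re0 x) *\<^sub>R x - ((norm x)\<^sup>2) *\<^sub>R 1" for x :: quat
  by (simp add: quat_eq_iff power2_norm_eq_inner inner_quat_def algebra_simps)

lemma quat_power_in_span: "x ^ n \<in> span {1, x}" for x :: quat
proof (induction n)
  case 0
  show ?case by (simp add: span_base)
next
  case (Suc n)
  then obtain a b where "x ^ n = a *\<^sub>R 1 + b *\<^sub>R x"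
    by (auto simp: span_insert span_singleton algebra_simps)
  then have "x ^ Suc n = a *\<^sub>R x + b *\<^sub>R (x * x)"
    by (simp add: algebra_simps)
  then show ?case
    by (simp add: quat_square span_base span_add span_diff span_scale)
qed

text \<open>The partial sums of the series lie in this subspace, which is closed because it is
  finite-dimensional.\<close>

lemma quat_exp_in_span: "exp x \<in> span {1, x}" for x :: quat
proof (rule closed_sequentially)
  show "closed (span {1, x})"
    by (simp add: closed_subspace)
  show "(\<Sum>i<n. x ^ i /\<^sub>R fact i) \<in> span {1, x}" for n
    by (intro span_sum span_scale quat_power_in_span)
  show "(\<lambda>n. \<Sum>i<n. x ^ i /\<^sub>R fact i) \<longlonglongrightarrow> exp x"
    using exp_converges[of x] by (simp add: sums_def)
qed

lemma phi_eq: obtains a b where "phi p s = a *\<^sub>R 1 + b *\<^sub>R p"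
proof -
  obtain a b where "exp (s *\<^sub>R p) = a *\<^sub>R 1 + b *\<^sub>R (s *\<^sub>R p)"
    using quat_exp_in_span[of "s *\<^sub>R p"]
    by (auto simp: span_insert span_singleton algebra_simps)
  then show thesis
    by (intro that[of a "b * s"]) (simp add: phi_def)
qed

lemma Re0_mult_commute: "Re0 (x * y) = Re0 (y * x)"
  by simp

lemma Re0_phi_swap:
  "Re0 (phi p s * phi q s * (phi p t * phi q t)) = Re0 (phi q s * phi p s * (phi q t * phi p t))"
proof -
  obtain a b where 1: "phi p s = a *\<^sub>R 1 + b *\<^sub>R p" by (rule phi_eq)
  obtain c d where 2: "phi q s = c *\<^sub>R 1 + d *\<^sub>R q" by (rule phi_eq)
  obtain e f where 3: "phi p t = e *\<^sub>R 1 + f *\<^sub>R p" by (rule phi_eq)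
  obtain g h where 4: "phi q t = g *\<^sub>R 1 + h *\<^sub>R q" by (rule phi_eq)
  show ?thesis
    \<comment> \<open>In coordinates this is a polynomial identity, valid for arbitrary coefficients
      \<open>a\<close>, ..., \<open>h\<close>.\<close>
    unfolding 1 2 3 4 times_quat.sel plus_quat.sel scaleR_quat.sel one_quat.sel
    by algebra
qed

lemma Re0_square_mult: "Re0 (x * x * y) = 2 * Re0 x * Re0 (x * y) - (norm x)\<^sup>2 * Re0 y"
  unfolding quat_square by (simp add: algebra_simps)

lemma Re0_phi_swap_square:
  "Re0 (phi p s * phi q s * (phi p s * phi q s) * (phi p t * phi q t)) =
   Re0 (phi q s * phi p s * (phi q s * phi p s) * (phi q t * phi p t))"
  \<comment> \<open>With the mixed terms matched, only norms and real parts of two-factor products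
    remain.\<close>
  unfolding Re0_square_mult Re0_phi_swap[of p s q t]
  by (simp only: norm_mult mult.commute[of "norm (phi p s)"]
      Re0_mult_commute[of "phi p s"] Re0_mult_commute[of "phi p t"])

theorem proposition4p2:
  fixes p q :: quat
  assumes "pure_quat p" and "pure_quat q"
  shows "(\<forall>s t :: real.
            Tr (phi p s * phi q s * phi p t * phi q t) =
            Tr (phi q s * phi p s * phi q t * phi p t)) \<and>
         (\<forall>r s t :: real. r = s \<or> s = t \<or> r = t \<longrightarrow>
            Tr (phi p r * phi q r * phi p s * phi q s * phi p t * phi q t) =
            Tr (phi q r * phi p r * phi q s * phi p s * phi q t * phi p t))"
proof (intro conjI allI impI)
  fix s t
  show "Tr (phi p s * phi q s * phi p t * phi q t) = Tr (phi q s * phi p s * phi q t * phi p t)"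
    using Re0_phi_swap[of p s q t] by (simp only: Tr_eq mult.assoc)
next
  fix r s t :: real
  define A where "A = (\<lambda>u. phi p u * phi q u)"
  define A' where "A' = (\<lambda>u. phi q u * phi p u)"
  have swap: "Re0 (A u * A u * A v) = Re0 (A' u * A' u * A' v)" for u v
    unfolding A_def A'_def by (rule Re0_phi_swap_square)
  have cyclic: "Re0 (x * y * z) = Re0 (y * z * x)" for x y z
    by (metis Re0_mult_commute mult.assoc)
  assume "r = s \<or> s = t \<or> r = t"
  \<comment> \<open>Rotation brings the two equal factors to the front, where \<open>swap\<close>
    applies.\<close>
  then have "Re0 (A r * A s * A t) = Re0 (A' r * A' s * A' t)"
    using swap cyclic by metis
  then show "Tr (phi p r * phi q r * phi p s * phi q s * phi p t * phi q t) =
      Tr (phi q r * phi p r * phi q s * phi p s * phi q t * phi p t)"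
    by (simp only: Tr_eq A_def A'_def mult.assoc)
qed

end
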